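(* Let $R$ be a regularly nil clean ring. Then $R$ is $(m,n)$-regularly nil clean for all positive integers $m,n$.
   Context: All rings are associative with identity (not necessarily commutative). A ring $R$ is called regularly nil clean if for every $a\in R$ there exists an idempotent $e\in Ra$ such that $a(1-e)$ is nilpotent. For non-negative integers $m,n$, a ring $R$ is called $(m,n)$-regularly nil clean if for every $a\in R$ there exists an idempotent $e\in a^mRa^n$ such that $a^m(1-e)a^n$ is nilpotent. *)

theory Defs
  imports "HOL-Algebra.Ring"
begin

(* The locale "ring" is associative and unital, not necessarily commutative; the zero ring is
   included. *)

definition idempotent_elem :: "('a, 'b) ring_scheme \<Rightarrow> 'a \<Rightarrow> bool" where
  "idempotent_elem R e \<longleftrightarrow> e \<in> carrier R \<and> e \<otimes>\<^bsub>R\<^esub> e = e"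

definition nilpotent_elem :: "('a, 'b) ring_scheme \<Rightarrow> 'a \<Rightarrow> bool" where
  "nilpotent_elem R x \<longleftrightarrow> x \<in> carrier R \<and> (\<exists>k::nat. k > 0 \<and> x [^]\<^bsub>R\<^esub> k = \<zero>\<^bsub>R\<^esub>)"

definition regularly_nil_clean :: "('a, 'b) ring_scheme \<Rightarrow> bool" where
  "regularly_nil_clean R \<longleftrightarrow>
     (\<forall>a \<in> carrier R. \<exists>e \<in> {r \<otimes>\<^bsub>R\<^esub> a | r. r \<in> carrier R}.
        idempotent_elem R e \<and> nilpotent_elem R (a \<otimes>\<^bsub>R\<^esub> (\<one>\<^bsub>R\<^esub> \<ominus>\<^bsub>R\<^esub> e)))"

definition mn_regularly_nil_clean :: "nat \<Rightarrow> nat \<Rightarrow> ('a, 'b) ring_scheme \<Rightarrow> bool" where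
  "mn_regularly_nil_clean m n R \<longleftrightarrow>
     (\<forall>a \<in> carrier R. \<exists>e \<in> {a [^]\<^bsub>R\<^esub> m \<otimes>\<^bsub>R\<^esub> r \<otimes>\<^bsub>R\<^esub> a [^]\<^bsub>R\<^esub> n | r. r \<in> carrier R}.
        idempotent_elem R e \<and>
        nilpotent_elem R (a [^]\<^bsub>R\<^esub> m \<otimes>\<^bsub>R\<^esub> (\<one>\<^bsub>R\<^esub> \<ominus>\<^bsub>R\<^esub> e) \<otimes>\<^bsub>R\<^esub> a [^]\<^bsub>R\<^esub> n))"

end

(* Write b = a^(m+n) and let f = r b be an idempotent with r b r = r and b (1 - f) nilpotent.
   Then e = a^m r a^n is idempotent, and a^n (1 - e) a^m = b - b r b = b (1 - f) is nilpotent.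
   Nilpotency of x y and of y x are equivalent, so (1 - e) a^(m+n), and with it
   a^m (1 - e) a^n, is nilpotent as well. *)
theory Submission
  imports Defs
begin

context ring
begin

text \<open>Peeling the first \<open>y\<close> and the last \<open>x\<close> off the alternating
  product leaves a power of \<open>x \<otimes> y\<close>, so vanishing powers of
  \<open>x \<otimes> y\<close> can be transferred to \<open>y \<otimes> x\<close>.\<close>

lemma nat_pow_swap:
  assumes "x \<in> carrier R" and "y \<in> carrier R"
  shows "(y \<otimes> x) [^] Suc k = y \<otimes> (x \<otimes> y) [^] k \<otimes> x"
proof (induction k)
  case 0
  show ?case
    using assms by simp
next
  case (Suc k)
  have "(y \<otimes> x) [^] Suc (Suc k) = (y \<otimes> x) [^] Suc k \<otimes> (y \<otimes> x)"
    by (rule nat_pow_Suc)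
  also have "\<dots> = y \<otimes> (x \<otimes> y) [^] k \<otimes> x \<otimes> (y \<otimes> x)"
    by (simp only: Suc.IH)
  also have "\<dots> = y \<otimes> (x \<otimes> y) [^] Suc k \<otimes> x"
    using assms by (simp add: m_assoc)
  finally show ?case .
qed

lemma nilpotent_elem_swap:
  assumes "x \<in> carrier R" and "y \<in> carrier R" and "nilpotent_elem R (x \<otimes> y)"
  shows "nilpotent_elem R (y \<otimes> x)"
proof -
  obtain k :: nat where "(x \<otimes> y) [^] k = \<zero>"
    using assms(3) unfolding nilpotent_elem_def by blast
  \<comment> \<open>The exponent grows by one, which also makes it visibly positive, as
    \<open>nilpotent_elem\<close> demands.\<close>
  then have "(y \<otimes> x) [^] Suc k = \<zero>"
    using assms(1,2) by (simp only: nat_pow_swap) simp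
  then show ?thesis
    using assms(1,2) unfolding nilpotent_elem_def by blast
qed

text \<open>The definition only yields \<open>s\<close> with \<open>s \<otimes> b\<close>
  idempotent. Replacing \<open>s\<close> by \<open>s \<otimes> b \<otimes> s\<close> keeps this
  idempotent, hence the nilpotent element, and gains the reflexive identity that later makes
  \<open>u \<otimes> r \<otimes> v\<close> idempotent.\<close>

lemma regularly_nil_clean_obtain_inner_inverse:
  assumes "regularly_nil_clean R" and b: "b \<in> carrier R"
  obtains r where "r \<in> carrier R" and "r \<otimes> b \<otimes> r = r"
    and "nilpotent_elem R (b \<otimes> (\<one> \<ominus> r \<otimes> b))"
proof -
  obtain s where s: "s \<in> carrier R" and idem: "s \<otimes> b \<otimes> (s \<otimes> b) = s \<otimes> b"
    and nil: "nilpotent_elem R (b \<otimes> (\<one> \<ominus> s \<otimes> b))"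
    using assms unfolding regularly_nil_clean_def idempotent_elem_def by blast
  show thesis
  proof
    show "s \<otimes> b \<otimes> s \<in> carrier R"
      using s b by simp
    have rb: "s \<otimes> b \<otimes> s \<otimes> b = s \<otimes> b"
      using s b idem by (simp add: m_assoc)
    have "s \<otimes> b \<otimes> s \<otimes> b \<otimes> (s \<otimes> b \<otimes> s) = s \<otimes> b \<otimes> (s \<otimes> b) \<otimes> s"
      using s b by (simp only: rb) (simp add: m_assoc)
    then show "s \<otimes> b \<otimes> s \<otimes> b \<otimes> (s \<otimes> b \<otimes> s) = s \<otimes> b \<otimes> s"
      by (simp only: idem)
    show "nilpotent_elem R (b \<otimes> (\<one> \<ominus> s \<otimes> b \<otimes> s \<otimes> b))"
      using nil by (simp only: rb)
  qed
qed

lemma regularly_nil_clean_imp_mn: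
  assumes "regularly_nil_clean R"
  shows "mn_regularly_nil_clean m n R"
  unfolding mn_regularly_nil_clean_def
proof
  fix a assume a: "a \<in> carrier R"
  define u v where "u = a [^] m" and "v = a [^] n"
  have u: "u \<in> carrier R" and v: "v \<in> carrier R"
    using a by (simp_all add: u_def v_def)
  \<comment> \<open>Apart from closure, this is all that is used about \<open>u\<close> and
    \<open>v\<close> being powers of \<open>a\<close>.\<close>
  have comm: "u \<otimes> v = v \<otimes> u"
    using a by (simp add: u_def v_def nat_pow_mult add.commute)
  \<comment> \<open>The order \<open>v \<otimes> u\<close> is chosen to match the middle of \<open>u
    \<otimes> r \<otimes> v \<otimes> u \<otimes> r \<otimes> v\<close>, the square of the
    \<open>e\<close> below.\<close>
  obtain r where r: "r \<in> carrier R" and rbr: "r \<otimes> (v \<otimes> u) \<otimes> r = r"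
    and nil: "nilpotent_elem R (v \<otimes> u \<otimes> (\<one> \<ominus> r \<otimes> (v \<otimes> u)))"
    using regularly_nil_clean_obtain_inner_inverse[OF assms, of "v \<otimes> u"] u v by auto
  define e where "e = u \<otimes> r \<otimes> v"
  have e: "e \<in> carrier R"
    using u v r by (simp add: e_def)
  have "e \<otimes> e = u \<otimes> (r \<otimes> (v \<otimes> u) \<otimes> r) \<otimes> v"
    using u v r by (simp add: e_def m_assoc)
  then have "idempotent_elem R e"
    using e by (simp add: rbr idempotent_elem_def flip: e_def)
  moreover have "nilpotent_elem R (u \<otimes> (\<one> \<ominus> e) \<otimes> v)"
  proof -
    \<comment> \<open>Moving \<open>u\<close> from the left of the bracket to its right turns
      \<open>r \<otimes> (v \<otimes> u)\<close> into \<open>e\<close>.\<close>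
    have "v \<otimes> u \<otimes> (\<one> \<ominus> r \<otimes> (v \<otimes> u)) = v \<otimes> ((\<one> \<ominus> e) \<otimes> u)"
      using u v r by (simp add: e_def minus_eq l_distr r_distr l_minus r_minus m_assoc)
    then have "nilpotent_elem R ((\<one> \<ominus> e) \<otimes> u \<otimes> v)"
      using nil nilpotent_elem_swap[of v "(\<one> \<ominus> e) \<otimes> u"] u v e by simp
    \<comment> \<open>Commuting the two powers puts \<open>u\<close> last, so that the second swap
      carries \<open>u\<close>, not \<open>v\<close>, to the front.\<close>
    then have "nilpotent_elem R ((\<one> \<ominus> e) \<otimes> v \<otimes> u)"
      using u v e by (simp add: m_assoc comm)
    then show ?thesis
      using nilpotent_elem_swap[of "(\<one> \<ominus> e) \<otimes> v" u] u v e by (simp add: m_assoc)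
  qed
  ultimately show "\<exists>e \<in> {a [^] m \<otimes> r \<otimes> a [^] n | r. r \<in> carrier R}.
      idempotent_elem R e \<and> nilpotent_elem R (a [^] m \<otimes> (\<one> \<ominus> e) \<otimes> a [^] n)"
    using r unfolding e_def u_def v_def by blast
qed

end

theorem proposition2p2:
  fixes R :: "('a, 'b) ring_scheme"
  assumes "ring R"
    and "regularly_nil_clean R"
  shows "\<forall>m n :: nat. m > 0 \<longrightarrow> n > 0 \<longrightarrow> mn_regularly_nil_clean m n R"
  using ring.regularly_nil_clean_imp_mn[OF assms] by blast

end
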